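(* Let $X_j$, $j\geq 1$, be a collection of i.i.d. (strictly) positive real random variables defined on a probability space $(\Omega,\mathcal{F},P)$, having finite logarithmic variance $\sigma_\ell^2$ and logarithmic mean $m_\ell$. For $K\geq 1$ let $\hat m_\ell(X)=\left(\prod_{j=1}^K X_j\right)^{1/K}$ be their empirical logarithmic mean. Then $\hat m_\ell(X)$ is an unbiased estimator of the logarithmic mean $m_\ell$, and $$\hat m_\ell(X)=\left(\prod_{j=1}^K X_j\right)^{1/K}\rightarrow m_\ell$$ almost surely with respect to $P$ as $K\to\infty$.
   Context: For a strictly positive real random variable $X$ with square integrable logarithm, the logarithmic mean is $m_\ell(X)=\exp(E[\ln X])$, and the logarithmic variance is $\sigma_\ell^2(X)=E[(\ln X-\ln m_\ell(X))^2]=\mathrm{Var}(\ln X)$.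
   Formalization: Unbiasedness is read logarithmically: the logarithmic mean of the estimator equals m_ℓ, i.e. E[ln m̂] = ln m_ℓ. The literal E[m̂] = m_ℓ fails, e.g. K=1 and X = e or 1/e with probability 1/2 each, where E[X] = cosh 1 > 1 = m_ℓ. *)

theory Defs
  imports "HOL-Probability.Probability"
begin

text \<open>Strictly positive real random variables with square integrable logarithm. On a probability
  space this entails integrability of \<open>ln X\<close>, so both integrals below are genuine.\<close>

definition log_square_integrable :: "'a measure \<Rightarrow> ('a \<Rightarrow> real) \<Rightarrow> bool" where
  "log_square_integrable M X \<longleftrightarrow>
     X \<in> borel_measurable M \<and> (\<forall>\<omega>\<in>space M. 0 < X \<omega>) \<and>
     integrable M (\<lambda>\<omega>. (ln (X \<omega>))\<^sup>2)"

definition log_mean :: "'a measure \<Rightarrow> ('a \<Rightarrow> real) \<Rightarrow> real" where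
  "log_mean M X = exp (\<integral>\<omega>. ln (X \<omega>) \<partial>M)"

definition log_variance :: "'a measure \<Rightarrow> ('a \<Rightarrow> real) \<Rightarrow> real" where
  "log_variance M X = (\<integral>\<omega>. (ln (X \<omega>) - ln (log_mean M X))\<^sup>2 \<partial>M)"

definition empirical_log_mean :: "(nat \<Rightarrow> 'a \<Rightarrow> real) \<Rightarrow> nat \<Rightarrow> 'a \<Rightarrow> real" where
  "empirical_log_mean X K \<omega> = (\<Prod>j=1..K. X j \<omega>) powr (1 / real K)"

text \<open>Unbiasedness is understood with respect to the logarithmic mean instead of the expectation:
  by Jensen's inequality the expectation of the empirical logarithmic mean exceeds
  \<open>log_mean M (X 1)\<close> (possibly being infinite) unless the sample is almost surely constant.
  The first conjunct says that the logarithmic mean of the estimator is well defined.\<close>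

definition log_unbiased_estimator :: "'a measure \<Rightarrow> ('a \<Rightarrow> real) \<Rightarrow> real \<Rightarrow> bool" where
  "log_unbiased_estimator M T m \<longleftrightarrow> log_square_integrable M T \<and> log_mean M T = m"

end

theory Submission
  imports Defs "HOL-Library.Discrete_Functions"
begin

text \<open>
  Taking logarithms turns the empirical logarithmic mean into the arithmetic mean of the i.i.d.
  variables \<open>ln (X j)\<close>, which are square integrable. Linearity of the integral then gives
  unbiasedness, and the almost sure convergence is the strong law of large numbers for the
  logarithms, carried back by the continuity of \<open>exp\<close>.

  The strong law rests on second moments. Let \<open>S k\<close> be the sum of the first \<open>k\<close> centred
  variables and \<open>v\<close> a bound for their variances. Independence enters only through
  orthogonality, which bounds the second moment of a sum of \<open>m\<close> of them by \<open>m * v\<close>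
  (lemma \<open>integral_power2_sum_orthogonal_le\<close>). The mean square of \<open>S k / k\<close> is therefore at most
  \<open>v / k\<close>, which is not summable; but the bound is summable along the squares \<open>k = n\<^sup>2\<close>. Between
  \<open>n\<^sup>2\<close> and \<open>(n + 1)\<^sup>2\<close> only \<open>2 * n + 1\<close> values of \<open>k\<close> occur, and for each of them the increment
  \<open>S k - S (n\<^sup>2)\<close> has at most \<open>2 * n\<close> summands. Adding up the squares of \<^emph>\<open>all\<close> these increments
  still only costs a second moment of order \<open>n\<^sup>2\<close>, which after division by \<open>n ^ 4\<close> is summable. A
  sequence of nonnegative functions with summable integrals tends to zero almost everywhere
  (lemma \<open>AE_tendsto_0_of_summable_integrals\<close>), so this controls all \<open>k\<close> at once.
\<close>

section \<open>Almost everywhere convergence from summable integrals\<close>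

text \<open>By monotone convergence the sum of the functions has a finite integral, so the series
  converges almost everywhere, and the terms of a convergent series tend to zero.\<close>

lemma AE_tendsto_0_of_summable_integrals:
  fixes W :: "nat \<Rightarrow> 'a \<Rightarrow> real"
  assumes int: "\<And>n. integrable M (W n)"
    and nonneg: "\<And>n x. 0 \<le> W n x"
    and summable: "summable (\<lambda>n. \<integral>x. W n x \<partial>M)"
  shows "AE x in M. (\<lambda>n. W n x) \<longlonglongrightarrow> 0"
proof -
  have [measurable]: "W n \<in> borel_measurable M" for n
    using int by auto
  have "(\<integral>\<^sup>+x. (\<Sum>n. ennreal (W n x)) \<partial>M) = (\<Sum>n. \<integral>\<^sup>+x. ennreal (W n x) \<partial>M)"
    by (rule nn_integral_suminf) measurable
  also have "\<dots> = (\<Sum>n. ennreal (\<integral>x. W n x \<partial>M))"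
    by (simp add: nn_integral_eq_integral int nonneg)
  also have "\<dots> = ennreal (\<Sum>n. \<integral>x. W n x \<partial>M)"
    using summable by (intro suminf_ennreal2) (simp_all add: nonneg)
  finally have "(\<integral>\<^sup>+x. (\<Sum>n. ennreal (W n x)) \<partial>M) \<noteq> \<infinity>"
    by simp
  then have "AE x in M. (\<Sum>n. ennreal (W n x)) \<noteq> \<infinity>"
    by (intro nn_integral_PInf_AE) auto
  then show ?thesis
  proof eventually_elim
    case (elim x)
    then have "summable (\<lambda>n. W n x)"
      by (intro summable_suminf_not_top nonneg) simp
    then show ?case
      by (rule summable_LIMSEQ_zero)
  qed
qed

section \<open>Second moments of orthogonal sums\<close>

lemma integrable_mult_of_square_integrable:
  fixes f g :: "'a \<Rightarrow> real"
  assumes [measurable]: "f \<in> borel_measurable M" "g \<in> borel_measurable M"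
    and "integrable M (\<lambda>x. (f x)\<^sup>2)" "integrable M (\<lambda>x. (g x)\<^sup>2)"
  shows "integrable M (\<lambda>x. f x * g x)"
proof (rule Bochner_Integration.integrable_bound)
  show "integrable M (\<lambda>x. (f x)\<^sup>2 + (g x)\<^sup>2)"
    using assms by simp
  have "\<bar>a * b\<bar> \<le> a\<^sup>2 + b\<^sup>2" for a b :: real
  proof -
    have "2 * \<bar>a\<bar> * \<bar>b\<bar> \<le> a\<^sup>2 + b\<^sup>2"
      using sum_squares_bound[of "\<bar>a\<bar>" "\<bar>b\<bar>"] by simp
    moreover have "0 \<le> \<bar>a\<bar> * \<bar>b\<bar>"
      by simp
    ultimately show ?thesis
      unfolding abs_mult by linarith
  qed
  then show "AE x in M. norm (f x * g x) \<le> norm ((f x)\<^sup>2 + (g x)\<^sup>2)"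
    by simp
qed measurable

lemma power2_sum_eq_double_sum:
  fixes y :: "'i \<Rightarrow> 'b::comm_semiring_1"
  shows "(\<Sum>i\<in>I. y i)\<^sup>2 = (\<Sum>i\<in>I. \<Sum>j\<in>I. y i * y j)"
  by (simp add: power2_eq_square sum_product)

lemma integrable_power2_sum:
  fixes Y :: "'i \<Rightarrow> 'a \<Rightarrow> real"
  assumes "\<And>i. i \<in> I \<Longrightarrow> Y i \<in> borel_measurable M"
    and "\<And>i. i \<in> I \<Longrightarrow> integrable M (\<lambda>x. (Y i x)\<^sup>2)"
  shows "integrable M (\<lambda>x. (\<Sum>i\<in>I. Y i x)\<^sup>2)"
  unfolding power2_sum_eq_double_sum
  by (intro Bochner_Integration.integrable_sum integrable_mult_of_square_integrable assms)

text \<open>This is Pythagoras' theorem in \<open>L\<^sup>2\<close>: the off-diagonal terms of the squared sum integrate to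
  zero.\<close>

lemma integral_power2_sum_orthogonal_le:
  fixes Y :: "'i \<Rightarrow> 'a \<Rightarrow> real"
  assumes fin: "finite I"
    and meas: "\<And>i. i \<in> I \<Longrightarrow> Y i \<in> borel_measurable M"
    and sq: "\<And>i. i \<in> I \<Longrightarrow> integrable M (\<lambda>x. (Y i x)\<^sup>2)"
    and bound: "\<And>i. i \<in> I \<Longrightarrow> (\<integral>x. (Y i x)\<^sup>2 \<partial>M) \<le> v"
    and orth: "\<And>i j. i \<in> I \<Longrightarrow> j \<in> I \<Longrightarrow> i \<noteq> j \<Longrightarrow> (\<integral>x. Y i x * Y j x \<partial>M) = 0"
  shows "(\<integral>x. (\<Sum>i\<in>I. Y i x)\<^sup>2 \<partial>M) \<le> real (card I) * v"
proof -
  have int: "integrable M (\<lambda>x. Y i x * Y j x)" if "i \<in> I" "j \<in> I" for i j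
    using that by (intro integrable_mult_of_square_integrable meas sq)
  have "(\<integral>x. (\<Sum>i\<in>I. Y i x)\<^sup>2 \<partial>M) = (\<Sum>i\<in>I. \<Sum>j\<in>I. \<integral>x. Y i x * Y j x \<partial>M)"
    unfolding power2_sum_eq_double_sum
    by (simp add: int)
  also have "\<dots> = (\<Sum>i\<in>I. \<Sum>j\<in>I. if i = j then \<integral>x. (Y i x)\<^sup>2 \<partial>M else 0)"
    by (intro sum.cong refl) (simp add: orth power2_eq_square)
  also have "\<dots> = (\<Sum>i\<in>I. \<integral>x. (Y i x)\<^sup>2 \<partial>M)"
    using fin by simp
  also have "\<dots> \<le> real (card I) * v"
    by (rule sum_bounded_above) (rule bound)
  finally show ?thesis .
qed

section \<open>The strong law of large numbers\<close>

text \<open>The single function \<open>W n\<close> of the proof dominates \<open>(S k / k)\<^sup>2 / 2\<close> for every \<open>k\<close> in the block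
  from \<open>n\<^sup>2\<close> up to the next square, and its integral is of order \<open>1 / n\<^sup>2\<close>. Hence \<open>W n\<close> tends to
  zero almost everywhere, and \<open>S k / k\<close> follows with \<open>n\<close> the integer square root of \<open>k\<close>.\<close>

theorem strong_law_orthogonal:
  fixes Y :: "nat \<Rightarrow> 'a \<Rightarrow> real"
  assumes meas [measurable]: "\<And>i. Y i \<in> borel_measurable M"
    and sq: "\<And>i. integrable M (\<lambda>x. (Y i x)\<^sup>2)"
    and bound: "\<And>i. (\<integral>x. (Y i x)\<^sup>2 \<partial>M) \<le> v"
    and orth: "\<And>i j. i \<noteq> j \<Longrightarrow> (\<integral>x. Y i x * Y j x \<partial>M) = 0"
  shows "AE x in M. (\<lambda>k. (\<Sum>i<k. Y i x) / real k) \<longlonglongrightarrow> 0"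
proof -
  define S where "S k x = (\<Sum>i<k. Y i x)" for k x
  define W where
    "W n x = ((S (n\<^sup>2) x)\<^sup>2 + (\<Sum>i\<le>2*n. (S (n\<^sup>2 + i) x - S (n\<^sup>2) x)\<^sup>2)) / real n ^ 4" for n x
  have v: "0 \<le> v"
    using bound[of 0] by (rule order_trans[rotated]) simp
  have S_diff: "S (m + i) x - S m x = (\<Sum>j\<in>{m..<m+i}. Y j x)" for m i x
    unfolding S_def lessThan_atLeast0
    by (subst sum.atLeastLessThan_concat[of 0 m "m + i", symmetric]) simp_all
  have int_S: "integrable M (\<lambda>x. (S k x)\<^sup>2)" for k
    unfolding S_def by (intro integrable_power2_sum sq meas)
  have int_diff: "integrable M (\<lambda>x. (S (m + i) x - S m x)\<^sup>2)" for m i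
    unfolding S_diff by (intro integrable_power2_sum sq meas)
  have mom_S: "(\<integral>x. (S k x)\<^sup>2 \<partial>M) \<le> real k * v" for k
    using integral_power2_sum_orthogonal_le[where I = "{..<k}" and Y = Y and v = v]
      meas sq bound orth
    by (simp add: S_def)
  have mom_diff: "(\<integral>x. (S (m + i) x - S m x)\<^sup>2 \<partial>M) \<le> real i * v" for m i
    using integral_power2_sum_orthogonal_le[where I = "{m..<m+i}" and Y = Y and v = v]
      meas sq bound orth
    by (simp add: S_diff)
  have int_W: "integrable M (W n)" for n
    unfolding W_def
    by (intro integrable_divide_zero Bochner_Integration.integrable_add
        Bochner_Integration.integrable_sum int_S int_diff)
  have W_nonneg: "0 \<le> W n x" for n x
    unfolding W_def by (intro divide_nonneg_nonneg add_nonneg_nonneg sum_nonneg) simp_all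
  have mom_W: "(\<integral>x. W n x \<partial>M) \<le> 7 * v * inverse (real n ^ 2)" for n
  proof (cases "n = 0")
    case False
    have "(\<integral>x. W n x \<partial>M) = ((\<integral>x. (S (n\<^sup>2) x)\<^sup>2 \<partial>M)
        + (\<Sum>i\<le>2*n. \<integral>x. (S (n\<^sup>2 + i) x - S (n\<^sup>2) x)\<^sup>2 \<partial>M)) / real n ^ 4"
      unfolding W_def
      by (simp add: int_S int_diff)
    also have "\<dots> \<le> (real (n\<^sup>2) * v + real (2 * n + 1) * (real (2 * n) * v)) / real n ^ 4"
    proof (intro divide_right_mono add_mono mom_S)
      have "(\<Sum>i\<le>2*n. \<integral>x. (S (n\<^sup>2 + i) x - S (n\<^sup>2) x)\<^sup>2 \<partial>M)
          \<le> real (card {..2*n}) * (real (2 * n) * v)"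
      proof (rule sum_bounded_above)
        fix i assume "i \<in> {..2*n}"
        then have "real i * v \<le> real (2 * n) * v"
          using v by (intro mult_right_mono) auto
        then show "(\<integral>x. (S (n\<^sup>2 + i) x - S (n\<^sup>2) x)\<^sup>2 \<partial>M) \<le> real (2 * n) * v"
          using mom_diff[of "n\<^sup>2" i] by linarith
      qed
      then show "(\<Sum>i\<le>2*n. \<integral>x. (S (n\<^sup>2 + i) x - S (n\<^sup>2) x)\<^sup>2 \<partial>M)
          \<le> real (2 * n + 1) * (real (2 * n) * v)"
        by simp
    qed simp
    also have "\<dots> \<le> (7 * v * (real n)\<^sup>2) / real n ^ 4"
    proof (rule divide_right_mono)
      (* The numerator is 5 * n\<^sup>2 * v + 2 * n * v, and n \<le> n\<^sup>2. *)
      have "real n * v \<le> real n * v * real n"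
        using v False by (simp add: mult_le_cancel_left1 mult_less_0_iff)
      then show "real (n\<^sup>2) * v + real (2 * n + 1) * (real (2 * n) * v) \<le> 7 * v * (real n)\<^sup>2"
        by (simp add: algebra_simps power2_eq_square)
    qed simp
    also have "\<dots> = 7 * v * inverse (real n ^ 2)"
      using False by (simp add: field_simps power4_eq_xxxx power2_eq_square)
    finally show ?thesis .
  qed (simp add: W_def)
  have "summable (\<lambda>n. \<integral>x. W n x \<partial>M)"
  proof (rule summable_comparison_test')
    show "summable (\<lambda>n. 7 * v * inverse (real n ^ 2))"
      by (intro summable_mult inverse_power_summable) simp
    show "norm (\<integral>x. W n x \<partial>M) \<le> 7 * v * inverse (real n ^ 2)" for n
      using mom_W[of n] by (simp add: W_nonneg)
  qed
  then have "AE x in M. (\<lambda>n. W n x) \<longlonglongrightarrow> 0"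
    by (intro AE_tendsto_0_of_summable_integrals int_W W_nonneg)
  moreover have "(\<lambda>k. S k x / real k) \<longlonglongrightarrow> 0" if W0: "(\<lambda>n. W n x) \<longlonglongrightarrow> 0" for x
  proof -
    (* The block of k starts at the square of floor_sqrt k. *)
    have le: "(S k x / real k)\<^sup>2 \<le> 2 * W (floor_sqrt k) x" if "0 < k" for k
    proof -
      define n where "n = floor_sqrt k"
      define i where "i = k - n\<^sup>2"
      have k: "k = n\<^sup>2 + i"
        unfolding i_def n_def by simp
      have "k < (Suc n)\<^sup>2"
        unfolding n_def by (rule Suc_floor_sqrt_power2_gt)
      then have i: "i \<le> 2 * n"
        unfolding k by (simp add: power2_eq_square)
      have n: "0 < n"
        using that by (simp add: n_def)
      define a where "a = S (n\<^sup>2) x"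
      define b where "b = S (n\<^sup>2 + i) x - S (n\<^sup>2) x"
      have "(S k x)\<^sup>2 = (a + b)\<^sup>2"
        unfolding k a_def b_def by simp
      also have "\<dots> \<le> 2 * (a\<^sup>2 + b\<^sup>2)"
        using sum_squares_bound[of a b] by (simp add: power2_sum)
      also have "b\<^sup>2 \<le> (\<Sum>i\<le>2*n. (S (n\<^sup>2 + i) x - S (n\<^sup>2) x)\<^sup>2)"
        unfolding b_def using i
        by (intro member_le_sum[where f = "\<lambda>i. (S (n\<^sup>2 + i) x - S (n\<^sup>2) x)\<^sup>2"]) auto
      finally have "(S k x)\<^sup>2 \<le> 2 * (a\<^sup>2 + (\<Sum>i\<le>2*n. (S (n\<^sup>2 + i) x - S (n\<^sup>2) x)\<^sup>2))"
        by simp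
      moreover have "real n ^ 4 \<le> (real k)\<^sup>2"
      proof -
        have "(real (n\<^sup>2))\<^sup>2 \<le> (real k)\<^sup>2"
          unfolding k by (intro power_mono) simp_all
        then show ?thesis
          by simp
      qed
      ultimately have "(S k x)\<^sup>2 / (real k)\<^sup>2
          \<le> 2 * (a\<^sup>2 + (\<Sum>i\<le>2*n. (S (n\<^sup>2 + i) x - S (n\<^sup>2) x)\<^sup>2)) / real n ^ 4"
        using n by (intro frac_le) (simp_all add: sum_nonneg)
      then show ?thesis
        by (simp add: W_def a_def power_divide flip: n_def)
    qed
    have "filterlim floor_sqrt at_top at_top"
      unfolding filterlim_at_top eventually_at_top_linorder by (meson le_floor_sqrt_iff)
    then have "(\<lambda>k. W (floor_sqrt k) x) \<longlonglongrightarrow> 0"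
      by (rule filterlim_compose[OF W0])
    then have lim: "(\<lambda>k. 2 * W (floor_sqrt k) x) \<longlonglongrightarrow> 0"
      by (rule tendsto_mult_right_zero)
    have "(\<lambda>k. (S k x / real k)\<^sup>2) \<longlonglongrightarrow> 0"
    proof (rule tendsto_sandwich[OF _ _ tendsto_const lim])
      show "\<forall>\<^sub>F k in sequentially. (S k x / real k)\<^sup>2 \<le> 2 * W (floor_sqrt k) x"
        using eventually_gt_at_top[of "0::nat"] by eventually_elim (rule le)
    qed simp
    then show ?thesis
      by simp
  qed
  ultimately show ?thesis
    unfolding S_def by auto
qed

text \<open>For independent variables the integral of a product of two centred ones factors into a product
  of vanishing means, so that they are orthogonal.\<close>

corollary (in prob_space) strong_law_square_integrable:
  fixes Z :: "nat \<Rightarrow> 'a \<Rightarrow> real"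
  assumes indep: "indep_vars (\<lambda>_. borel) Z {1..}"
    and sq: "\<And>i. 1 \<le> i \<Longrightarrow> integrable M (\<lambda>x. (Z i x)\<^sup>2)"
    and mean: "\<And>i. 1 \<le> i \<Longrightarrow> expectation (Z i) = \<mu>"
    and var: "\<And>i. 1 \<le> i \<Longrightarrow> variance (Z i) \<le> v"
  shows "AE x in M. (\<lambda>k. (\<Sum>i=1..k. Z i x) / real k) \<longlonglongrightarrow> \<mu>"
proof -
  have [measurable]: "Z (Suc i) \<in> borel_measurable M" for i
    using indep unfolding indep_vars_def by simp
  have int: "integrable M (Z (Suc i))" for i
    by (rule square_integrable_imp_integrable) (simp_all add: sq)
  have "AE x in M. (\<lambda>k. (\<Sum>i<k. Z (Suc i) x - \<mu>) / real k) \<longlonglongrightarrow> 0"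
  proof (rule strong_law_orthogonal)
    show "integrable M (\<lambda>x. (Z (Suc i) x - \<mu>)\<^sup>2)" for i
      by (simp add: power2_diff sq int)
    show "(\<integral>x. (Z (Suc i) x - \<mu>)\<^sup>2 \<partial>M) \<le> v" for i
      using var[of "Suc i"] by (simp add: mean)
    show "(\<integral>x. (Z (Suc i) x - \<mu>) * (Z (Suc j) x - \<mu>) \<partial>M) = 0" if "i \<noteq> j" for i j
    proof -
      have "indep_vars (\<lambda>_. borel) Z {Suc i, Suc j}"
        using indep by (rule indep_vars_subset) simp
      then have "indep_vars (\<lambda>_. borel) (\<lambda>i x. Z i x - \<mu>) {Suc i, Suc j}"
        by (rule indep_vars_compose2) simp
      then have "(\<integral>x. (\<Prod>l\<in>{Suc i, Suc j}. Z l x - \<mu>) \<partial>M)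
          = (\<Prod>l\<in>{Suc i, Suc j}. \<integral>x. Z l x - \<mu> \<partial>M)"
        by (intro indep_vars_lebesgue_integral) (auto simp: int)
      then show ?thesis
        using that by (simp add: int mean prob_space)
    qed
  qed measurable
  then show ?thesis
  proof eventually_elim
    case (elim x)
    have "(\<lambda>k. (\<Sum>i<k. Z (Suc i) x - \<mu>) / real k + \<mu>) \<longlonglongrightarrow> \<mu>"
      using tendsto_add[OF elim tendsto_const[of \<mu>]] by simp
    moreover have "\<forall>\<^sub>F k in sequentially.
        (\<Sum>i<k. Z (Suc i) x - \<mu>) / real k + \<mu> = (\<Sum>i=1..k. Z i x) / real k"
      using eventually_gt_at_top[of "0::nat"]
      by eventually_elim (simp add: sum_subtractf sum.atLeast1_atMost_eq field_simps)
    ultimately show ?case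
      by (rule Lim_transform_eventually)
  qed
qed

section \<open>The empirical logarithmic mean\<close>

text \<open>The logarithm of the empirical logarithmic mean is the arithmetic mean of the logarithms; for
  \<open>K = 0\<close> both sides are \<open>1\<close>, by the conventions on division by zero.\<close>

lemma empirical_log_mean_eq_exp:
  assumes "\<And>j. 1 \<le> j \<Longrightarrow> 0 < X j \<omega>"
  shows "empirical_log_mean X K \<omega> = exp ((\<Sum>j=1..K. ln (X j \<omega>)) / real K)"
proof -
  have nz: "X j \<omega> \<noteq> 0" if "j \<in> {1..K}" for j
    using assms[of j] that by simp
  then have "(\<Prod>j=1..K. X j \<omega>) \<noteq> 0"
    by simp
  moreover have "ln (\<Prod>j=1..K. X j \<omega>) = (\<Sum>j=1..K. ln (X j \<omega>))"
    by (rule ln_prod) (simp_all only: nz finite_atLeastAtMost not_False_eq_True)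
  ultimately show ?thesis
    by (simp only: empirical_log_mean_def powr_def if_False mult_1_left times_divide_eq_left)
qed

theorem theorem4p1:
  fixes M :: "'a measure" and X :: "nat \<Rightarrow> 'a \<Rightarrow> real" and m_l sigma2_l :: real
  assumes "prob_space M"
    and "prob_space.indep_vars M (\<lambda>_. borel) X {1..}"
    and "\<And>i j. 1 \<le> i \<Longrightarrow> 1 \<le> j \<Longrightarrow> distr M borel (X i) = distr M borel (X j)"
    and "\<And>j. 1 \<le> j \<Longrightarrow> log_square_integrable M (X j)"
    and "\<And>j. 1 \<le> j \<Longrightarrow> log_mean M (X j) = m_l"
    and "\<And>j. 1 \<le> j \<Longrightarrow> log_variance M (X j) = sigma2_l"
  shows "(\<forall>K\<ge>1. log_unbiased_estimator M (empirical_log_mean X K) m_l) \<and>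
         (AE \<omega> in M. (\<lambda>K. empirical_log_mean X K \<omega>) \<longlonglongrightarrow> m_l)"
proof -
  interpret prob_space M
    by fact
  have meas: "X j \<in> borel_measurable M"
    and pos: "\<omega> \<in> space M \<Longrightarrow> 0 < X j \<omega>"
    and sq: "integrable M (\<lambda>\<omega>. (ln (X j \<omega>))\<^sup>2)" if "1 \<le> j" for j \<omega>
    using assms(4)[OF that] by (auto simp: log_square_integrable_def)
  have meas_ln: "(\<lambda>\<omega>. ln (X j \<omega>)) \<in> borel_measurable M" if "1 \<le> j" for j
    using meas[OF that] by measurable
  have int: "integrable M (\<lambda>\<omega>. ln (X j \<omega>))" if "1 \<le> j" for j
    by (rule square_integrable_imp_integrable[OF meas_ln[OF that] sq[OF that]])
  have m_l: "m_l = exp (\<integral>\<omega>. ln (X 1 \<omega>) \<partial>M)"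
    using assms(5)[of 1] by (simp add: log_mean_def)
  have mean: "(\<integral>\<omega>. ln (X j \<omega>) \<partial>M) = ln m_l" if "1 \<le> j" for j
    using assms(5)[OF that] by (auto simp: log_mean_def)
  have emp: "empirical_log_mean X K \<omega> = exp ((\<Sum>j=1..K. ln (X j \<omega>)) / real K)"
    if "\<omega> \<in> space M" for K \<omega>
    using that by (intro empirical_log_mean_eq_exp pos)

  have "log_unbiased_estimator M (empirical_log_mean X K) m_l" if K: "1 \<le> K" for K
  proof -
    let ?A = "\<lambda>\<omega>. (\<Sum>j=1..K. ln (X j \<omega>)) / real K"
    have [measurable]: "?A \<in> borel_measurable M"
      by (intro borel_measurable_divide borel_measurable_sum meas_ln) auto
    have "empirical_log_mean X K \<in> borel_measurable M"
      by (subst measurable_cong[OF emp]) measurable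
    moreover have "integrable M (\<lambda>\<omega>. (ln (empirical_log_mean X K \<omega>))\<^sup>2)"
    proof -
      have "integrable M (\<lambda>\<omega>. (\<Sum>j=1..K. ln (X j \<omega>))\<^sup>2 / (real K)\<^sup>2)"
        by (intro integrable_divide_zero integrable_power2_sum meas_ln sq) auto
      then show ?thesis
        by (simp add: emp power_divide cong: Bochner_Integration.integrable_cong)
    qed
    moreover have "log_mean M (empirical_log_mean X K) = m_l"
    proof -
      have "(\<integral>\<omega>. ln (empirical_log_mean X K \<omega>) \<partial>M) = (\<integral>\<omega>. ?A \<omega> \<partial>M)"
        by (intro Bochner_Integration.integral_cong) (simp_all add: emp)
      also have "\<dots> = (\<Sum>j=1..K. \<integral>\<omega>. ln (X j \<omega>) \<partial>M) / real K"
        by (simp add: int)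
      also have "\<dots> = ln m_l"
        using K by (simp add: mean)
      finally show ?thesis
        by (simp add: log_mean_def m_l)
    qed
    ultimately show ?thesis
      by (simp add: log_unbiased_estimator_def log_square_integrable_def emp)
  qed

  moreover have "AE \<omega> in M. (\<lambda>K. empirical_log_mean X K \<omega>) \<longlonglongrightarrow> m_l"
  proof -
    have "indep_vars (\<lambda>_. borel) (\<lambda>j \<omega>. ln (X j \<omega>)) {1..}"
      using assms(2) by (rule indep_vars_compose2) simp
    moreover have "variance (\<lambda>\<omega>. ln (X j \<omega>)) \<le> sigma2_l" if "1 \<le> j" for j
      using assms(6)[OF that] by (simp add: log_variance_def log_mean_def)
    ultimately have "AE \<omega> in M. (\<lambda>K. (\<Sum>j=1..K. ln (X j \<omega>)) / real K) \<longlonglongrightarrow> ln m_l"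
      by (intro strong_law_square_integrable sq mean)
    with AE_space show ?thesis
    proof eventually_elim
      case (elim \<omega>)
      then have "(\<lambda>K. exp ((\<Sum>j=1..K. ln (X j \<omega>)) / real K)) \<longlonglongrightarrow> exp (ln m_l)"
        by (intro tendsto_exp)
      then show ?case
        using elim(1) by (simp add: emp m_l)
    qed
  qed
  ultimately show ?thesis
    by blast
qed

end
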